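(* (Blame-Subtyping Theorem.) Fix any BlameSafe structure. Let $\ell$ be a blame label and $M:\Gamma\vdash' A$ a term of $CC'(\Rightarrow)$. If $M$ is safe for $\ell$, then it is not the case that $M\longrightarrow^{*}\mathtt{blame}\,\ell$.
   Context: **Types.** Base types $b$: $\mathtt{Nat},\mathtt{Bool},\mathtt{Int},\mathtt{Unit},\bot$. Types: $A,B::=b\mid\,?\mid A\to B\mid A\times B\mid A+B$. Contexts $\Gamma$ are finite sequences of types; variables are de Bruijn indices (index $0$ is the last-added type). Primitive types $P::=b\mid b\to P$; each $b$ denotes a set (naturals, Booleans, integers, one-element set, empty set) and $[\![b\to P]\!]$ is the set of functions $[\![b]\!]\to[\![P]\!]$. Blame labels $\ell$ range over a fixed set. **PreCastStruct**: for all types $A,B$ a set $A\Rightarrow B$ of casts; predicates $\mathsf{Inert}$, $\mathsf{Active}$, $\mathsf{Cross}$ on casts; every cast is active or inert; every inert cast $c:A\Rightarrow(B\otimes C)$ with $\otimes\in\{\to,\times,+\}$ is a cross cast and $A=A_1\otimes A_2$ for some $A_1,A_2$; no cast into a base type is inert; and operations taking a cast $c$ and a proof $x$ of $\mathsf{Cross}\,c$: for $c:(A_1\to A_2)\Rightarrow(B_1\to B_2)$, $\mathsf{dom}\,c\,x:B_1\Rightarrow A_1$ and $\mathsf{cod}\,c\,x:A_2\Rightarrow B_2$; for $c:(A_1\times A_2)\Rightarrow(B_1\times B_2)$, $\mathsf{fst}\,c\,x:A_1\Rightarrow B_1$ and $\mathsf{snd}\,c\,x:A_2\Rightarrow B_2$;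 for $c:(A_1+A_2)\Rightarrow(B_1+B_2)$, $\mathsf{inl}\,c\,x:A_1\Rightarrow B_1$ and $\mathsf{inr}\,c\,x:A_2\Rightarrow B_2$. A **CastStruct** adds, for each value $V:\Gamma\vdash' A$, cast $c:A\Rightarrow B$ and $a:\mathsf{Active}\,c$, a term $\mathsf{applyCast}\,V\,c\,a:\Gamma\vdash' B$. **Terms** of $CC'(\Rightarrow)$ (intrinsically typed; $M:\Gamma\vdash' A$): $\$k:P$ for $k\in[\![P]\!]$; $`x:A$ if $x$ has type $A$ in $\Gamma$; $\lambda M:A\to B$ if $M:\Gamma\cdot A\vdash' B$; $L\,M:B$ if $L:A\to B$, $M:A$; $\mathtt{if}\,L\,M\,N:B$ if $L:\mathtt{Bool}$, $M,N:B$; $\mathtt{cons}\,M\,N:A\times B$; $\pi_iM:A_i$ if $M:A_1\times A_2$; $\mathtt{inl}[B]M:A+B$ if $M:A$; $\mathtt{inr}[A]M:A+B$ if $M:B$; $\mathtt{case}\,L\,M\,N:B$ if $L:\Gamma\vdash' A_1+A_2$, $M:\Gamma\cdot A_1\vdash' B$, $N:\Gamma\cdot A_2\vdash' B$; $M\langle c\rangle:B$ if $M:A$, $c:A\Rightarrow B$; $M\langle\!\langle c\rangle\!\rangle:B$ if $M:A$, $c:A\Rightarrow B$ and $c$ is inert; $\mathtt{blame}\,\ell:A$ for every $A$. **Values** $V,W$: $\lambda M$; $\$k$; $\mathtt{cons}\,V\,W$; $\mathtt{inl}[B]V$; $\mathtt{inr}[A]V$; $V\langle\!\langle c\rangle\!\rangle$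 ($c$ inert). **Frames** $F$: $\Box\,M$; $V\,\Box$; $\mathtt{if}\,\Box\,M\,N$; $\mathtt{cons}\,V\,\Box$; $\mathtt{cons}\,\Box\,N$; $\pi_i\Box$; $\mathtt{inl}[B]\Box$; $\mathtt{inr}[A]\Box$; $\mathtt{case}\,\Box\,M\,N$; $\Box\langle c\rangle$; $\Box\langle\!\langle c\rangle\!\rangle$. **Reduction** ($M[N]$ is substitution of $N$ for variable $0$, lowering the other free indices): - $F[M]\longrightarrow F[M']$ if $M\longrightarrow M'$; $F[\mathtt{blame}\,\ell]\longrightarrow\mathtt{blame}\,\ell$. - $V\langle c\rangle\longrightarrow\mathsf{applyCast}\,V\,c\,a$ for $a:\mathsf{Active}\,c$; $V\langle c\rangle\longrightarrow V\langle\!\langle c\rangle\!\rangle$ for $c$ inert. - For $c$ inert and $x:\mathsf{Cross}\,c$: $V\langle\!\langle c\rangle\!\rangle\,W\longrightarrow(V\,(W\langle\mathsf{dom}\,c\,x\rangle))\langle\mathsf{cod}\,c\,x\rangle$; $\pi_1(V\langle\!\langle c\rangle\!\rangle)\longrightarrow(\pi_1V)\langle\mathsf{fst}\,c\,x\rangle$; $\pi_2(V\langle\!\langle c\rangle\!\rangle)\longrightarrow(\pi_2V)\langle\mathsf{snd}\,c\,x\rangle$; $\mathtt{case}\,(V\langle\!\langle c\rangle\!\rangle)\,M\,N\longrightarrow\mathtt{case}\,V\,M'\,N'$, where $M'$ is $M$ with its bound variable $`0$ replaced by $`0\langle\mathsf{inl}\,c\,x\rangle$ and $N'$ is $N$ with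 its bound variable $`0$ replaced by $`0\langle\mathsf{inr}\,c\,x\rangle$. - $(\lambda M)\,V\longrightarrow M[V]$; $\mathtt{if}\,\$\mathtt{true}\,M\,N\longrightarrow M$; $\mathtt{if}\,\$\mathtt{false}\,M\,N\longrightarrow N$; $\pi_1(\mathtt{cons}\,V\,W)\longrightarrow V$; $\pi_2(\mathtt{cons}\,V\,W)\longrightarrow W$; $\mathtt{case}\,(\mathtt{inl}[B]V)\,M\,N\longrightarrow M[V]$; $\mathtt{case}\,(\mathtt{inr}[A]V)\,M\,N\longrightarrow N[V]$; $\$k\,\$k'\longrightarrow\$(k(k'))$. $\longrightarrow^{*}$ is the reflexive-transitive closure. **BlameSafe structure**: a CastStruct together with a predicate $\mathsf{CastBlameSafe}\,c\,\ell$ on casts $c$ and labels $\ell$ such that: (i) whenever $\mathsf{CastBlameSafe}\,c\,\ell$ and $x:\mathsf{Cross}\,c$, also $\mathsf{CastBlameSafe}\,c'\,\ell$ for $c'$ each of $\mathsf{dom}\,c\,x,\mathsf{cod}\,c\,x$ (if $c$ is between function types), $\mathsf{fst}\,c\,x,\mathsf{snd}\,c\,x$ (product types), $\mathsf{inl}\,c\,x,\mathsf{inr}\,c\,x$ (sum types); (ii) for every value $V:\Gamma\vdash' A$, $c:A\Rightarrow B$, $a:\mathsf{Active}\,c$: if $\mathsf{CastBlameSafe}\,c\,\ell$ and $V$ is safe for $\ell$, then $\mathsf{applyCast}\,V\,c\,a$ is safe for $\ell$. **Safe for.** $M$ is *safe for* $\ell$ iff every cast $c$ occurring in $M$ (in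 a subterm $N\langle c\rangle$ or $N\langle\!\langle c\rangle\!\rangle$) satisfies $\mathsf{CastBlameSafe}\,c\,\ell$ and every subterm $\mathtt{blame}\,\ell'$ of $M$ has $\ell'\neq\ell$. *)

theory Defs
  imports Main "HOL-Library.FuncSet"
begin

section \<open>Types and constants\<close>

datatype base = TNat | TBool | TInt | TUnit | TBot

datatype ty =
    Base base
  | Dyn
  | Fun ty ty   (infixr "\<rightarrow>\<^sub>t" 60)
  | Prod ty ty  (infixr "\<times>\<^sub>t" 64)
  | Sum ty ty   (infixr "+\<^sub>t" 62)

datatype prim = PBase base | PFun base prim

primrec ty_of_prim :: "prim \<Rightarrow> ty" where
  "ty_of_prim (PBase b) = Base b"
| "ty_of_prim (PFun b P) = Base b \<rightarrow>\<^sub>t ty_of_prim P"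

datatype base_val = VNat nat | VBool bool | VInt int | VUnit

primrec base_den :: "base \<Rightarrow> base_val set" where
  "base_den TNat = range VNat"
| "base_den TBool = range VBool"
| "base_den TInt = range VInt"
| "base_den TUnit = {VUnit}"
| "base_den TBot = {}"

text \<open>
  One HOL type contains the denotations of all primitive types.  Taking extensional functions
  (\<open>\<rightarrow>\<^sub>E\<close>) makes \<open>prim_den (PFun b P)\<close> an exact copy of the full set of functions from
  \<open>base_den b\<close> to \<open>prim_den P\<close>.
\<close>

datatype const_val = CBase base_val | CFun "base_val \<Rightarrow> const_val"

primrec prim_den :: "prim \<Rightarrow> const_val set" where
  "prim_den (PBase b) = CBase ` base_den b"
| "prim_den (PFun b P) = CFun ` (base_den b \<rightarrow>\<^sub>E prim_den P)"

fun const_app :: "const_val \<Rightarrow> const_val \<Rightarrow> const_val" where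
  "const_app (CFun f) (CBase v) = f v"
| "const_app _ _ = undefined"


section \<open>Terms\<close>

text \<open>
  Intrinsically typed terms are represented by raw terms together with the judgement
  \<open>has_type\<close> below.  Constants, abstractions, injections and blame carry the type information that
  a context does not determine, so that a typable raw term in a given context has exactly one type
  and one typing derivation, and hence stands for exactly one intrinsically typed term.
  The type parameters are the casts \<open>'c\<close> and the blame labels \<open>'l\<close>; the set functions
  \<open>casts_in\<close> and \<open>blames_in\<close> collect the casts and the labels occurring in a term.
\<close>

datatype (casts_in: 'c, blames_in: 'l) trm =
    Const prim const_val
  | Var nat
  | Lam ty "('c, 'l) trm"
  | App "('c, 'l) trm" "('c, 'l) trm"
  | Ite "('c, 'l) trm" "('c, 'l) trm" "('c, 'l) trm"
  | MkPair "('c, 'l) trm" "('c, 'l) trm"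
  | Proj1 "('c, 'l) trm"
  | Proj2 "('c, 'l) trm"
  | InjL ty "('c, 'l) trm"
  | InjR ty "('c, 'l) trm"
  | Case "('c, 'l) trm" "('c, 'l) trm" "('c, 'l) trm"
  | Cast "('c, 'l) trm" 'c
  | Wrap "('c, 'l) trm" 'c
  | Blame ty 'l

abbreviation Bool_const :: "bool \<Rightarrow> ('c, 'l) trm" where
  "Bool_const b \<equiv> Const (PBase TBool) (CBase (VBool b))"

definition up_ren :: "(nat \<Rightarrow> nat) \<Rightarrow> nat \<Rightarrow> nat" where
  "up_ren r = case_nat 0 (\<lambda>i. Suc (r i))"

primrec rename :: "(nat \<Rightarrow> nat) \<Rightarrow> ('c, 'l) trm \<Rightarrow> ('c, 'l) trm" where
  "rename r (Const P k) = Const P k"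
| "rename r (Var i) = Var (r i)"
| "rename r (Lam A M) = Lam A (rename (up_ren r) M)"
| "rename r (App L M) = App (rename r L) (rename r M)"
| "rename r (Ite L M N) = Ite (rename r L) (rename r M) (rename r N)"
| "rename r (MkPair M N) = MkPair (rename r M) (rename r N)"
| "rename r (Proj1 M) = Proj1 (rename r M)"
| "rename r (Proj2 M) = Proj2 (rename r M)"
| "rename r (InjL B M) = InjL B (rename r M)"
| "rename r (InjR A M) = InjR A (rename r M)"
| "rename r (Case L M N) = Case (rename r L) (rename (up_ren r) M) (rename (up_ren r) N)"
| "rename r (Cast M c) = Cast (rename r M) c"
| "rename r (Wrap M c) = Wrap (rename r M) c"
| "rename r (Blame A l) = Blame A l"

definition up_sub :: "(nat \<Rightarrow> ('c, 'l) trm) \<Rightarrow> nat \<Rightarrow> ('c, 'l) trm" where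
  "up_sub s = case_nat (Var 0) (\<lambda>i. rename Suc (s i))"

primrec subst :: "(nat \<Rightarrow> ('c, 'l) trm) \<Rightarrow> ('c, 'l) trm \<Rightarrow> ('c, 'l) trm" where
  "subst s (Const P k) = Const P k"
| "subst s (Var i) = s i"
| "subst s (Lam A M) = Lam A (subst (up_sub s) M)"
| "subst s (App L M) = App (subst s L) (subst s M)"
| "subst s (Ite L M N) = Ite (subst s L) (subst s M) (subst s N)"
| "subst s (MkPair M N) = MkPair (subst s M) (subst s N)"
| "subst s (Proj1 M) = Proj1 (subst s M)"
| "subst s (Proj2 M) = Proj2 (subst s M)"
| "subst s (InjL B M) = InjL B (subst s M)"
| "subst s (InjR A M) = InjR A (subst s M)"
| "subst s (Case L M N) = Case (subst s L) (subst (up_sub s) M) (subst (up_sub s) N)"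
| "subst s (Cast M c) = Cast (subst s M) c"
| "subst s (Wrap M c) = Wrap (subst s M) c"
| "subst s (Blame A l) = Blame A l"

definition subst0 :: "('c, 'l) trm \<Rightarrow> ('c, 'l) trm \<Rightarrow> ('c, 'l) trm" where
  "subst0 M N = subst (case_nat N Var) M"

text \<open>\<open>cast_var0 M c\<close> replaces variable 0 of \<open>M\<close> by itself cast along \<open>c\<close>;
  the other variables keep their indices, since the result stays under the same binder.\<close>

definition cast_var0 :: "('c, 'l) trm \<Rightarrow> 'c \<Rightarrow> ('c, 'l) trm" where
  "cast_var0 M c = subst (case_nat (Cast (Var 0) c) (\<lambda>i. Var (Suc i))) M"


section \<open>Cast structures\<close>

text \<open>
  \<open>cross S c\<close> and \<open>active S c\<close> are the sets of proofs that \<open>c\<close> is a cross cast and that \<open>c\<close> is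
  active, because the operations on casts take such proofs as arguments; the predicates hold when
  these sets are nonempty.  A proof-irrelevant predicate is the special case of the sets \<open>{}\<close> and
  \<open>{()}\<close>.
\<close>

record ('c, 'x, 'a) pre_cast_struct =
  casts :: "ty \<Rightarrow> ty \<Rightarrow> 'c set"
  inert :: "'c \<Rightarrow> bool"
  active :: "'c \<Rightarrow> 'a set"
  cross :: "'c \<Rightarrow> 'x set"
  dom_cast :: "'c \<Rightarrow> 'x \<Rightarrow> 'c"
  cod_cast :: "'c \<Rightarrow> 'x \<Rightarrow> 'c"
  fst_cast :: "'c \<Rightarrow> 'x \<Rightarrow> 'c"
  snd_cast :: "'c \<Rightarrow> 'x \<Rightarrow> 'c"
  inl_cast :: "'c \<Rightarrow> 'x \<Rightarrow> 'c"
  inr_cast :: "'c \<Rightarrow> 'x \<Rightarrow> 'c"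

text \<open>Disjointness expresses that a cast comes with its source and target type; an arbitrary
  family of sets is made disjoint by tagging casts with these two types.\<close>

locale PreCastStruct =
  fixes S :: "('c, 'x, 'a, 'z) pre_cast_struct_scheme"
  assumes casts_disjoint:
      "\<lbrakk>c \<in> casts S A B; c \<in> casts S A' B'\<rbrakk> \<Longrightarrow> A = A' \<and> B = B'"
    and active_or_inert:
      "c \<in> casts S A B \<Longrightarrow> active S c \<noteq> {} \<or> inert S c"
    and inert_fun:
      "\<lbrakk>c \<in> casts S A (B \<rightarrow>\<^sub>t C); inert S c\<rbrakk> \<Longrightarrow> cross S c \<noteq> {} \<and> (\<exists>A1 A2. A = A1 \<rightarrow>\<^sub>t A2)"
    and inert_prod:
      "\<lbrakk>c \<in> casts S A (B \<times>\<^sub>t C); inert S c\<rbrakk> \<Longrightarrow> cross S c \<noteq> {} \<and> (\<exists>A1 A2. A = A1 \<times>\<^sub>t A2)"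
    and inert_sum:
      "\<lbrakk>c \<in> casts S A (B +\<^sub>t C); inert S c\<rbrakk> \<Longrightarrow> cross S c \<noteq> {} \<and> (\<exists>A1 A2. A = A1 +\<^sub>t A2)"
    and base_not_inert:
      "c \<in> casts S A (Base b) \<Longrightarrow> \<not> inert S c"
    and dom_cast:
      "\<lbrakk>c \<in> casts S (A1 \<rightarrow>\<^sub>t A2) (B1 \<rightarrow>\<^sub>t B2); x \<in> cross S c\<rbrakk> \<Longrightarrow> dom_cast S c x \<in> casts S B1 A1"
    and cod_cast:
      "\<lbrakk>c \<in> casts S (A1 \<rightarrow>\<^sub>t A2) (B1 \<rightarrow>\<^sub>t B2); x \<in> cross S c\<rbrakk> \<Longrightarrow> cod_cast S c x \<in> casts S A2 B2"
    and fst_cast: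
      "\<lbrakk>c \<in> casts S (A1 \<times>\<^sub>t A2) (B1 \<times>\<^sub>t B2); x \<in> cross S c\<rbrakk> \<Longrightarrow> fst_cast S c x \<in> casts S A1 B1"
    and snd_cast:
      "\<lbrakk>c \<in> casts S (A1 \<times>\<^sub>t A2) (B1 \<times>\<^sub>t B2); x \<in> cross S c\<rbrakk> \<Longrightarrow> snd_cast S c x \<in> casts S A2 B2"
    and inl_cast:
      "\<lbrakk>c \<in> casts S (A1 +\<^sub>t A2) (B1 +\<^sub>t B2); x \<in> cross S c\<rbrakk> \<Longrightarrow> inl_cast S c x \<in> casts S A1 B1"
    and inr_cast:
      "\<lbrakk>c \<in> casts S (A1 +\<^sub>t A2) (B1 +\<^sub>t B2); x \<in> cross S c\<rbrakk> \<Longrightarrow> inr_cast S c x \<in> casts S A2 B2"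

text \<open>The head of a context is the type of variable 0.\<close>

inductive has_type ::
    "('c, 'x, 'a, 'z) pre_cast_struct_scheme \<Rightarrow> ty list \<Rightarrow> ('c, 'l) trm \<Rightarrow> ty \<Rightarrow> bool"
  for S where
  "k \<in> prim_den P \<Longrightarrow> has_type S \<Gamma> (Const P k) (ty_of_prim P)"
| "i < length \<Gamma> \<Longrightarrow> has_type S \<Gamma> (Var i) (\<Gamma> ! i)"
| "has_type S (A # \<Gamma>) M B \<Longrightarrow> has_type S \<Gamma> (Lam A M) (A \<rightarrow>\<^sub>t B)"
| "\<lbrakk>has_type S \<Gamma> L (A \<rightarrow>\<^sub>t B); has_type S \<Gamma> M A\<rbrakk> \<Longrightarrow> has_type S \<Gamma> (App L M) B"
| "\<lbrakk>has_type S \<Gamma> L (Base TBool); has_type S \<Gamma> M B; has_type S \<Gamma> N B\<rbrakk>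
    \<Longrightarrow> has_type S \<Gamma> (Ite L M N) B"
| "\<lbrakk>has_type S \<Gamma> M A; has_type S \<Gamma> N B\<rbrakk> \<Longrightarrow> has_type S \<Gamma> (MkPair M N) (A \<times>\<^sub>t B)"
| "has_type S \<Gamma> M (A \<times>\<^sub>t B) \<Longrightarrow> has_type S \<Gamma> (Proj1 M) A"
| "has_type S \<Gamma> M (A \<times>\<^sub>t B) \<Longrightarrow> has_type S \<Gamma> (Proj2 M) B"
| "has_type S \<Gamma> M A \<Longrightarrow> has_type S \<Gamma> (InjL B M) (A +\<^sub>t B)"
| "has_type S \<Gamma> M B \<Longrightarrow> has_type S \<Gamma> (InjR A M) (A +\<^sub>t B)"
| "\<lbrakk>has_type S \<Gamma> L (A1 +\<^sub>t A2); has_type S (A1 # \<Gamma>) M B; has_type S (A2 # \<Gamma>) N B\<rbrakk>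
    \<Longrightarrow> has_type S \<Gamma> (Case L M N) B"
| "\<lbrakk>has_type S \<Gamma> M A; c \<in> casts S A B\<rbrakk> \<Longrightarrow> has_type S \<Gamma> (Cast M c) B"
| "\<lbrakk>has_type S \<Gamma> M A; c \<in> casts S A B; inert S c\<rbrakk> \<Longrightarrow> has_type S \<Gamma> (Wrap M c) B"
| "has_type S \<Gamma> (Blame A l) A"

inductive is_value :: "('c, 'x, 'a, 'z) pre_cast_struct_scheme \<Rightarrow> ('c, 'l) trm \<Rightarrow> bool"
  for S where
  "is_value S (Lam A M)"
| "is_value S (Const P k)"
| "\<lbrakk>is_value S V; is_value S W\<rbrakk> \<Longrightarrow> is_value S (MkPair V W)"
| "is_value S V \<Longrightarrow> is_value S (InjL B V)"
| "is_value S V \<Longrightarrow> is_value S (InjR A V)"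
| "\<lbrakk>is_value S V; inert S c\<rbrakk> \<Longrightarrow> is_value S (Wrap V c)"

text \<open>\<open>apply_cast\<close> has the context of the value as an argument because a raw term does not
  determine it.\<close>

record ('c, 'x, 'a, 'l) cast_struct = "('c, 'x, 'a) pre_cast_struct" +
  apply_cast :: "ty list \<Rightarrow> ('c, 'l) trm \<Rightarrow> 'c \<Rightarrow> 'a \<Rightarrow> ('c, 'l) trm"

locale CastStruct = PreCastStruct S
  for S :: "('c, 'x, 'a, 'l, 'z) cast_struct_scheme" +
  assumes apply_cast:
    "\<lbrakk>is_value S V; has_type S \<Gamma> V A; c \<in> casts S A B; a \<in> active S c\<rbrakk>
      \<Longrightarrow> has_type S \<Gamma> (apply_cast S \<Gamma> V c a) B"


section \<open>Reduction\<close>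

datatype ('c, 'l) frame =
    FAppL "('c, 'l) trm"
  | FAppR "('c, 'l) trm"
  | FIte "('c, 'l) trm" "('c, 'l) trm"
  | FPairR "('c, 'l) trm"
  | FPairL "('c, 'l) trm"
  | FProj1
  | FProj2
  | FInjL ty
  | FInjR ty
  | FCase "('c, 'l) trm" "('c, 'l) trm"
  | FCast 'c
  | FWrap 'c

primrec plug :: "('c, 'l) frame \<Rightarrow> ('c, 'l) trm \<Rightarrow> ('c, 'l) trm" where
  "plug (FAppL M) L = App L M"
| "plug (FAppR V) M = App V M"
| "plug (FIte M N) L = Ite L M N"
| "plug (FPairR V) N = MkPair V N"
| "plug (FPairL N) M = MkPair M N"
| "plug FProj1 M = Proj1 M"
| "plug FProj2 M = Proj2 M"
| "plug (FInjL B) M = InjL B M"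
| "plug (FInjR A) M = InjR A M"
| "plug (FCase M N) L = Case L M N"
| "plug (FCast c) M = Cast M c"
| "plug (FWrap c) M = Wrap M c"

fun is_frame :: "('c, 'x, 'a, 'z) pre_cast_struct_scheme \<Rightarrow> ('c, 'l) frame \<Rightarrow> bool" where
  "is_frame S (FAppR V) = is_value S V"
| "is_frame S (FPairR V) = is_value S V"
| "is_frame S (FWrap c) = inert S c"
| "is_frame S _ = True"

text \<open>\<open>step S \<Gamma>\<close> is reduction of terms in context \<open>\<Gamma>\<close>.  The typing premise of \<open>step_blame\<close>
  computes the type annotation of the resulting blame.\<close>

inductive step ::
    "('c, 'x, 'a, 'l, 'z) cast_struct_scheme \<Rightarrow> ty list \<Rightarrow> ('c, 'l) trm \<Rightarrow> ('c, 'l) trm \<Rightarrow> bool"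
  for S \<Gamma> where
  step_frame: "\<lbrakk>is_frame S F; step S \<Gamma> M M'\<rbrakk> \<Longrightarrow> step S \<Gamma> (plug F M) (plug F M')"
| step_blame: "\<lbrakk>is_frame S F; has_type S \<Gamma> (plug F (Blame A l)) B\<rbrakk>
    \<Longrightarrow> step S \<Gamma> (plug F (Blame A l)) (Blame B l)"
| step_cast: "\<lbrakk>is_value S V; a \<in> active S c\<rbrakk> \<Longrightarrow> step S \<Gamma> (Cast V c) (apply_cast S \<Gamma> V c a)"
| step_wrap: "\<lbrakk>is_value S V; inert S c\<rbrakk> \<Longrightarrow> step S \<Gamma> (Cast V c) (Wrap V c)"
| step_fun_cast: "\<lbrakk>is_value S V; is_value S W; inert S c; x \<in> cross S c\<rbrakk>
    \<Longrightarrow> step S \<Gamma> (App (Wrap V c) W)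
          (Cast (App V (Cast W (dom_cast S c x))) (cod_cast S c x))"
| step_fst_cast: "\<lbrakk>is_value S V; inert S c; x \<in> cross S c\<rbrakk>
    \<Longrightarrow> step S \<Gamma> (Proj1 (Wrap V c)) (Cast (Proj1 V) (fst_cast S c x))"
| step_snd_cast: "\<lbrakk>is_value S V; inert S c; x \<in> cross S c\<rbrakk>
    \<Longrightarrow> step S \<Gamma> (Proj2 (Wrap V c)) (Cast (Proj2 V) (snd_cast S c x))"
| step_case_cast: "\<lbrakk>is_value S V; inert S c; x \<in> cross S c\<rbrakk>
    \<Longrightarrow> step S \<Gamma> (Case (Wrap V c) M N)
          (Case V (cast_var0 M (inl_cast S c x)) (cast_var0 N (inr_cast S c x)))"
| step_beta: "is_value S V \<Longrightarrow> step S \<Gamma> (App (Lam A M) V) (subst0 M V)"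
| step_if_true: "step S \<Gamma> (Ite (Bool_const True) M N) M"
| step_if_false: "step S \<Gamma> (Ite (Bool_const False) M N) N"
| step_fst: "\<lbrakk>is_value S V; is_value S W\<rbrakk> \<Longrightarrow> step S \<Gamma> (Proj1 (MkPair V W)) V"
| step_snd: "\<lbrakk>is_value S V; is_value S W\<rbrakk> \<Longrightarrow> step S \<Gamma> (Proj2 (MkPair V W)) W"
| step_case_inl: "is_value S V \<Longrightarrow> step S \<Gamma> (Case (InjL B V) M N) (subst0 M V)"
| step_case_inr: "is_value S V \<Longrightarrow> step S \<Gamma> (Case (InjR A V) M N) (subst0 N V)"
| step_delta: "step S \<Gamma> (App (Const (PFun b P) k) (Const (PBase b) k')) (Const P (const_app k k'))"


section \<open>Blame safety\<close>

record ('c, 'x, 'a, 'l) blame_safe_struct = "('c, 'x, 'a, 'l) cast_struct" +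
  cast_blame_safe :: "'c \<Rightarrow> 'l \<Rightarrow> bool"

definition safe_for ::
    "('c, 'x, 'a, 'l, 'z) blame_safe_struct_scheme \<Rightarrow> 'l \<Rightarrow> ('c, 'l) trm \<Rightarrow> bool" where
  "safe_for S l M \<longleftrightarrow> (\<forall>c \<in> casts_in M. cast_blame_safe S c l) \<and> (\<forall>l' \<in> blames_in M. l' \<noteq> l)"

locale BlameSafe = CastStruct S
  for S :: "('c, 'x, 'a, 'l, 'z) blame_safe_struct_scheme" +
  assumes safe_fun:
      "\<lbrakk>c \<in> casts S (A1 \<rightarrow>\<^sub>t A2) (B1 \<rightarrow>\<^sub>t B2); cast_blame_safe S c l; x \<in> cross S c\<rbrakk>
        \<Longrightarrow> cast_blame_safe S (dom_cast S c x) l \<and> cast_blame_safe S (cod_cast S c x) l"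
    and safe_prod:
      "\<lbrakk>c \<in> casts S (A1 \<times>\<^sub>t A2) (B1 \<times>\<^sub>t B2); cast_blame_safe S c l; x \<in> cross S c\<rbrakk>
        \<Longrightarrow> cast_blame_safe S (fst_cast S c x) l \<and> cast_blame_safe S (snd_cast S c x) l"
    and safe_sum:
      "\<lbrakk>c \<in> casts S (A1 +\<^sub>t A2) (B1 +\<^sub>t B2); cast_blame_safe S c l; x \<in> cross S c\<rbrakk>
        \<Longrightarrow> cast_blame_safe S (inl_cast S c x) l \<and> cast_blame_safe S (inr_cast S c x) l"
    and safe_apply_cast:
      "\<lbrakk>is_value S V; has_type S \<Gamma> V A; c \<in> casts S A B; a \<in> active S c;
        cast_blame_safe S c l; safe_for S l V\<rbrakk>
        \<Longrightarrow> safe_for S l (apply_cast S \<Gamma> V c a)"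

end

theory Submission
  imports Defs
begin

text \<open>
  Typing and safety for \<open>l\<close> are preserved together by reduction, and \<open>Blame A l\<close> is not safe
  for \<open>l\<close>.  Safety alone is not preserved: the hypotheses on casts created by a step, those on
  \<open>apply_cast\<close> in particular, apply only to well-typed redexes.
\<close>

section \<open>Inversion of the typing judgement\<close>

inductive_cases has_type_ConstE: "has_type S \<Gamma> (Const P k) A"
inductive_cases has_type_VarE: "has_type S \<Gamma> (Var i) A"
inductive_cases has_type_LamE: "has_type S \<Gamma> (Lam A M) B"
inductive_cases has_type_AppE: "has_type S \<Gamma> (App L M) B"
inductive_cases has_type_IteE: "has_type S \<Gamma> (Ite L M N) B"
inductive_cases has_type_MkPairE: "has_type S \<Gamma> (MkPair M N) B"
inductive_cases has_type_Proj1E: "has_type S \<Gamma> (Proj1 M) B"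
inductive_cases has_type_Proj2E: "has_type S \<Gamma> (Proj2 M) B"
inductive_cases has_type_InjLE: "has_type S \<Gamma> (InjL A M) B"
inductive_cases has_type_InjRE: "has_type S \<Gamma> (InjR A M) B"
inductive_cases has_type_CaseE: "has_type S \<Gamma> (Case L M N) B"
inductive_cases has_type_CastE: "has_type S \<Gamma> (Cast M c) B"
inductive_cases has_type_WrapE: "has_type S \<Gamma> (Wrap M c) B"
inductive_cases has_type_BlameE: "has_type S \<Gamma> (Blame B l) A"

lemmas has_type_elims = has_type_ConstE has_type_VarE has_type_LamE has_type_AppE has_type_IteE
  has_type_MkPairE has_type_Proj1E has_type_Proj2E has_type_InjLE has_type_InjRE has_type_CaseE
  has_type_CastE has_type_WrapE has_type_BlameE

section \<open>Typing under renaming and substitution\<close>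

lemma has_type_Var:
  "\<lbrakk>i < length \<Gamma>; A = \<Gamma> ! i\<rbrakk> \<Longrightarrow> has_type S \<Gamma> (Var i) A"
  by (auto intro: has_type.intros)

lemma has_type_rename:
  assumes "has_type S \<Gamma> M A"
    and "\<And>i. i < length \<Gamma> \<Longrightarrow> r i < length \<Delta> \<and> \<Delta> ! r i = \<Gamma> ! i"
  shows "has_type S \<Delta> (rename r M) A"
  using assms
proof (induction arbitrary: r \<Delta> rule: has_type.induct)
  case (3 A \<Gamma> M B)
  have "has_type S (A # \<Delta>) (rename (up_ren r) M) B"
    using "3.prems" by (intro "3.IH") (auto simp: up_ren_def split: nat.splits)
  then show ?case by (auto intro: has_type.intros)
next
  case (11 \<Gamma> L A1 A2 M B N)
  have "has_type S (A1 # \<Delta>) (rename (up_ren r) M) B"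
    using "11.prems" by (intro "11.IH") (auto simp: up_ren_def split: nat.splits)
  moreover have "has_type S (A2 # \<Delta>) (rename (up_ren r) N) B"
    using "11.prems" by (intro "11.IH") (auto simp: up_ren_def split: nat.splits)
  moreover have "has_type S \<Delta> (rename r L) (A1 +\<^sub>t A2)"
    using "11.prems" by (intro "11.IH")
  ultimately show ?case by (auto intro: has_type.intros)
next
  case (4 \<Gamma> L A B M)
  have "has_type S \<Delta> (rename r L) (A \<rightarrow>\<^sub>t B)" "has_type S \<Delta> (rename r M) A"
    using "4.prems" by (intro "4.IH"; simp)+
  then show ?case by (auto intro: has_type.intros)
qed (auto intro: has_type.intros has_type_Var)

text \<open>Carries the hypothesis of \<open>has_type_subst\<close> under a binder. Images of the
  old variables are shifted by \<open>Suc\<close>, and weakening, an instance of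
  \<open>has_type_rename\<close>, retypes them.\<close>

lemma has_type_up_sub:
  assumes "\<And>i. i < length \<Gamma> \<Longrightarrow> has_type S \<Delta> (s i) (\<Gamma> ! i)"
    and "i < length (A # \<Gamma>)"
  shows "has_type S (A # \<Delta>) (up_sub s i) ((A # \<Gamma>) ! i)"
proof (cases i)
  case 0
  then show ?thesis by (simp add: up_sub_def has_type_Var)
next
  case (Suc j)
  then have "has_type S (A # \<Delta>) (rename Suc (s j)) (\<Gamma> ! j)"
    using assms by (intro has_type_rename) auto
  with Suc show ?thesis by (simp add: up_sub_def)
qed

lemma has_type_subst:
  assumes "has_type S \<Gamma> M A"
    and "\<And>i. i < length \<Gamma> \<Longrightarrow> has_type S \<Delta> (s i) (\<Gamma> ! i)"
  shows "has_type S \<Delta> (subst s M) A"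
  using assms
proof (induction arbitrary: s \<Delta> rule: has_type.induct)
  case (3 A \<Gamma> M B)
  have "has_type S (A # \<Delta>) (subst (up_sub s) M) B"
    using "3.prems" by (intro "3.IH" has_type_up_sub)
  then show ?case by (auto intro: has_type.intros)
next
  case (11 \<Gamma> L A1 A2 M B N)
  have "has_type S (A1 # \<Delta>) (subst (up_sub s) M) B"
    using "11.prems" by (intro "11.IH" has_type_up_sub)
  moreover have "has_type S (A2 # \<Delta>) (subst (up_sub s) N) B"
    using "11.prems" by (intro "11.IH" has_type_up_sub)
  moreover have "has_type S \<Delta> (subst s L) (A1 +\<^sub>t A2)"
    using "11.prems" by (intro "11.IH")
  ultimately show ?case by (auto intro: has_type.intros)
next
  case (4 \<Gamma> L A B M)
  have "has_type S \<Delta> (subst s L) (A \<rightarrow>\<^sub>t B)" "has_type S \<Delta> (subst s M) A"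
    using "4.prems" by (intro "4.IH"; simp)+
  then show ?case by (auto intro: has_type.intros)
qed (auto intro: has_type.intros)

lemma has_type_subst0:
  "\<lbrakk>has_type S (A # \<Gamma>) M B; has_type S \<Gamma> V A\<rbrakk> \<Longrightarrow> has_type S \<Gamma> (subst0 M V) B"
  unfolding subst0_def
  by (erule has_type_subst) (auto split: nat.splits intro: has_type_Var)

text \<open>The binder now ranges over the source type of \<open>c\<close>, while each occurrence is
  cast back to the type \<open>B\<close> that \<open>M\<close> expects. The other indices are fixed
  because both contexts have the tail \<open>\<Gamma>\<close>.\<close>

lemma has_type_cast_var0:
  "\<lbrakk>has_type S (B # \<Gamma>) M C; c \<in> casts S A B\<rbrakk> \<Longrightarrow> has_type S (A # \<Gamma>) (cast_var0 M c) C"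
  unfolding cast_var0_def
  by (erule has_type_subst)
    (auto split: nat.splits intro: has_type.intros(12) has_type_Var)

section \<open>Safety under renaming and substitution\<close>

lemma safe_for_simps [simp]:
  "safe_for S l (Const P k)"
  "safe_for S l (Var i)"
  "safe_for S l (Lam A M) \<longleftrightarrow> safe_for S l M"
  "safe_for S l (App L M) \<longleftrightarrow> safe_for S l L \<and> safe_for S l M"
  "safe_for S l (Ite L M N) \<longleftrightarrow> safe_for S l L \<and> safe_for S l M \<and> safe_for S l N"
  "safe_for S l (MkPair M N) \<longleftrightarrow> safe_for S l M \<and> safe_for S l N"
  "safe_for S l (Proj1 M) \<longleftrightarrow> safe_for S l M"
  "safe_for S l (Proj2 M) \<longleftrightarrow> safe_for S l M"
  "safe_for S l (InjL A M) \<longleftrightarrow> safe_for S l M"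
  "safe_for S l (InjR A M) \<longleftrightarrow> safe_for S l M"
  "safe_for S l (Case L M N) \<longleftrightarrow> safe_for S l L \<and> safe_for S l M \<and> safe_for S l N"
  "safe_for S l (Cast M c) \<longleftrightarrow> safe_for S l M \<and> cast_blame_safe S c l"
  "safe_for S l (Wrap M c) \<longleftrightarrow> safe_for S l M \<and> cast_blame_safe S c l"
  "safe_for S l (Blame A l') \<longleftrightarrow> l' \<noteq> l"
  by (auto simp: safe_for_def)

lemma safe_for_rename [simp]: "safe_for S l (rename r M) \<longleftrightarrow> safe_for S l M"
  by (induction M arbitrary: r) auto

lemma safe_for_up_sub:
  "(\<And>i. safe_for S l (s i)) \<Longrightarrow> safe_for S l (up_sub s i)"
  by (auto simp: up_sub_def split: nat.splits)

text \<open>A cast or label in \<open>subst s M\<close> stems from \<open>M\<close> or from some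
  \<open>s i\<close>. Asking for safety at every index suits the substitutions used below, which
  send all indices but 0 to variables.\<close>

lemma safe_for_subst:
  "\<lbrakk>safe_for S l M; \<And>i. safe_for S l (s i)\<rbrakk> \<Longrightarrow> safe_for S l (subst s M)"
  by (induction M arbitrary: s) (auto simp: safe_for_up_sub)

lemma safe_for_subst0:
  "\<lbrakk>safe_for S l M; safe_for S l V\<rbrakk> \<Longrightarrow> safe_for S l (subst0 M V)"
  unfolding subst0_def by (erule safe_for_subst) (auto split: nat.splits)

lemma safe_for_cast_var0:
  "\<lbrakk>safe_for S l M; cast_blame_safe S c l\<rbrakk> \<Longrightarrow> safe_for S l (cast_var0 M c)"
  unfolding cast_var0_def by (erule safe_for_subst) (auto split: nat.splits)

section \<open>Frames and uniqueness of types\<close>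

text \<open>Frames bind no variable, so the hole is typed in the same \<open>\<Gamma>\<close>. The
  second conclusion lets a reduct replace the redex in the hole.\<close>

lemma has_type_plugE:
  assumes "has_type S \<Gamma> (plug F M) B"
  obtains A where "has_type S \<Gamma> M A"
    and "\<And>M'. has_type S \<Gamma> M' A \<Longrightarrow> has_type S \<Gamma> (plug F M') B"
  using assms by (cases F) (auto elim!: has_type_elims intro: has_type.intros)

lemma safe_for_plugD: "safe_for S l (plug F M) \<Longrightarrow> safe_for S l M"
  by (cases F) auto

lemma safe_for_plug_mono:
  "\<lbrakk>safe_for S l (plug F M); safe_for S l M'\<rbrakk> \<Longrightarrow> safe_for S l (plug F M')"
  by (cases F) auto

text \<open>Serves the \<open>step_blame\<close> case, where the rule supplies its own type for the
  plugged term. Annotations settle the type of constants, abstractions, injections and blame; for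
  \<open>Cast\<close> and \<open>Wrap\<close> it is the target of the cast, unique by
  \<open>casts_disjoint\<close>.\<close>

lemma has_type_unique: "\<lbrakk>has_type S \<Gamma> M A; PreCastStruct S; has_type S \<Gamma> M B\<rbrakk> \<Longrightarrow> A = B"
proof (induction arbitrary: B rule: has_type.induct)
  case (12 \<Gamma> M A c B)
  then show ?case by (elim has_type_CastE) (metis PreCastStruct.casts_disjoint)
next
  case (13 \<Gamma> M A c B)
  then show ?case by (elim has_type_WrapE) (metis PreCastStruct.casts_disjoint)
qed (erule has_type_elims; blast dest: ty.inject[THEN iffD1])+

lemma const_app_in_prim_den:
  "\<lbrakk>k \<in> prim_den (PFun b P); k' \<in> prim_den (PBase b)\<rbrakk> \<Longrightarrow> const_app k k' \<in> prim_den P"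
  by (auto simp: PiE_mem)

section \<open>Source types of inert casts\<close>

context PreCastStruct
begin

text \<open>Typing a \<open>Wrap\<close> includes inertness of its cast, and an inert cast into a
  function type starts from a function type. This gives \<open>c\<close> the shape that
  \<open>dom_cast\<close>, \<open>cod_cast\<close> and \<open>safe_fun\<close> demand; products and
  sums are analogous.\<close>

lemma has_type_Wrap_FunE:
  assumes "has_type S \<Gamma> (Wrap V c) (B1 \<rightarrow>\<^sub>t B2)"
  obtains A1 A2 where "has_type S \<Gamma> V (A1 \<rightarrow>\<^sub>t A2)" "c \<in> casts S (A1 \<rightarrow>\<^sub>t A2) (B1 \<rightarrow>\<^sub>t B2)"
  using assms by (elim has_type_WrapE) (metis inert_fun)

lemma has_type_Wrap_ProdE:
  assumes "has_type S \<Gamma> (Wrap V c) (B1 \<times>\<^sub>t B2)"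
  obtains A1 A2 where "has_type S \<Gamma> V (A1 \<times>\<^sub>t A2)" "c \<in> casts S (A1 \<times>\<^sub>t A2) (B1 \<times>\<^sub>t B2)"
  using assms by (elim has_type_WrapE) (metis inert_prod)

lemma has_type_Wrap_SumE:
  assumes "has_type S \<Gamma> (Wrap V c) (B1 +\<^sub>t B2)"
  obtains A1 A2 where "has_type S \<Gamma> V (A1 +\<^sub>t A2)" "c \<in> casts S (A1 +\<^sub>t A2) (B1 +\<^sub>t B2)"
  using assms by (elim has_type_WrapE) (metis inert_sum)

end

section \<open>Preservation of typing and safety\<close>

lemma (in BlameSafe) step_preserves_type_and_safety:
  assumes "step S \<Gamma> M N" "has_type S \<Gamma> M A" "safe_for S l M"
  shows "has_type S \<Gamma> N A \<and> safe_for S l N"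
  using assms
\<comment> \<open>The type is generalised because the frame case applies the induction hypothesis at
  the type of the hole.\<close>
proof (induction arbitrary: A rule: step.induct)
  case (step_frame F M M')
  then show ?case
    by (metis has_type_plugE safe_for_plugD safe_for_plug_mono)
next
  case (step_blame F A' l' B)
  \<comment> \<open>\<open>B\<close> comes from the typing premise of the rule, \<open>A\<close>
    from the assumed typing of the same term. Safety then passes from the plugged blame to the
    result, as both carry the label \<open>l'\<close>.\<close>
  then have "A = B"
    using has_type_unique PreCastStruct_axioms by blast
  then show ?case
    using step_blame.prems by (auto dest: safe_for_plugD intro: has_type.intros)
next
  case (step_cast V a c)
  \<comment> \<open>Inverting the typing of the cast types \<open>V\<close> at the source of
    \<open>c\<close>, as both hypotheses on \<open>apply_cast\<close> require.\<close>
  then show ?case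
    by (auto elim!: has_type_CastE intro: apply_cast safe_apply_cast)
next
  case (step_wrap V c)
  then show ?case
    by (auto elim!: has_type_CastE intro: has_type.intros)
next
  case (step_fun_cast V W c x)
  then obtain B where "has_type S \<Gamma> (Wrap V c) (B \<rightarrow>\<^sub>t A)" and W: "has_type S \<Gamma> W B"
    by (auto elim: has_type_AppE)
  then obtain A1 A2 where "has_type S \<Gamma> V (A1 \<rightarrow>\<^sub>t A2)" "c \<in> casts S (A1 \<rightarrow>\<^sub>t A2) (B \<rightarrow>\<^sub>t A)"
    by (elim has_type_Wrap_FunE)
  then show ?case
    using W step_fun_cast.hyps step_fun_cast.prems dom_cast cod_cast safe_fun
    by (fastforce intro: has_type.intros)
next
  case (step_fst_cast V c x)
  then obtain B where "has_type S \<Gamma> (Wrap V c) (A \<times>\<^sub>t B)"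
    by (auto elim: has_type_Proj1E)
  then obtain A1 A2 where "has_type S \<Gamma> V (A1 \<times>\<^sub>t A2)" "c \<in> casts S (A1 \<times>\<^sub>t A2) (A \<times>\<^sub>t B)"
    by (rule has_type_Wrap_ProdE)
  then show ?case
    using step_fst_cast.hyps step_fst_cast.prems fst_cast safe_prod
    by (fastforce intro: has_type.intros)
next
  case (step_snd_cast V c x)
  then obtain B where "has_type S \<Gamma> (Wrap V c) (B \<times>\<^sub>t A)"
    by (auto elim: has_type_Proj2E)
  then obtain A1 A2 where "has_type S \<Gamma> V (A1 \<times>\<^sub>t A2)" "c \<in> casts S (A1 \<times>\<^sub>t A2) (B \<times>\<^sub>t A)"
    by (rule has_type_Wrap_ProdE)
  then show ?case
    using step_snd_cast.hyps step_snd_cast.prems snd_cast safe_prod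
    by (fastforce intro: has_type.intros)
next
  case (step_case_cast V c x M N)
  then obtain B1 B2 where "has_type S \<Gamma> (Wrap V c) (B1 +\<^sub>t B2)"
    and MN: "has_type S (B1 # \<Gamma>) M A" "has_type S (B2 # \<Gamma>) N A"
    by (auto elim: has_type_CaseE)
  then obtain A1 A2 where V: "has_type S \<Gamma> V (A1 +\<^sub>t A2)"
    and c: "c \<in> casts S (A1 +\<^sub>t A2) (B1 +\<^sub>t B2)"
    by (elim has_type_Wrap_SumE)
  \<comment> \<open>With the wrapper removed, the scrutinee \<open>V\<close> has the source sum
    type, so the branches must be typed with its summands \<open>A1\<close> and \<open>A2\<close> in
    place of \<open>B1\<close> and \<open>B2\<close>.\<close>
  have "has_type S (A1 # \<Gamma>) (cast_var0 M (inl_cast S c x)) A"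
    "has_type S (A2 # \<Gamma>) (cast_var0 N (inr_cast S c x)) A"
    using MN c step_case_cast.hyps
    by (auto intro: has_type_cast_var0 inl_cast inr_cast)
  then show ?case
    using V safe_sum[OF c] step_case_cast.hyps step_case_cast.prems
    by (auto intro: has_type.intros safe_for_cast_var0)
next
  case (step_delta b P k k')
  then have "const_app k k' \<in> prim_den P"
    by (intro const_app_in_prim_den) (auto elim!: has_type_elims)
  then show ?case
    using step_delta by (auto elim!: has_type_elims intro: has_type.intros)
qed (auto elim!: has_type_elims intro: has_type_subst0 safe_for_subst0)

theorem theorem13:
  fixes S :: "('c, 'x, 'a, 'l) blame_safe_struct"
    and l :: 'l and \<Gamma> :: "ty list" and M :: "('c, 'l) trm" and A :: ty
  assumes "BlameSafe S"
    and "has_type S \<Gamma> M A"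
    and "safe_for S l M"
  shows "\<not> (step S \<Gamma>)\<^sup>*\<^sup>* M (Blame A l)"
proof
  assume "(step S \<Gamma>)\<^sup>*\<^sup>* M (Blame A l)"
  then have "has_type S \<Gamma> (Blame A l) A \<and> safe_for S l (Blame A l)"
    using assms(2,3)
    by (induction rule: rtranclp_induct)
      (auto dest: BlameSafe.step_preserves_type_and_safety[OF assms(1)])
  \<comment> \<open>Safety of \<open>Blame A l\<close> for \<open>l\<close> unfolds to
    \<open>l \<noteq> l\<close>.\<close>
  then show False by simp
qed

end
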